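(* Let $n\ge 3$ and $k\geq 1$ be integers, and let $\alpha=\frac1k\sum_{i=1}^k\delta_{\mathbf{x}^i}$ and $\beta=\frac1k\sum_{i=1}^k\delta_{\mathbf{y}^i}$ be empirical measures of size $k$ in $\mathbb{R}^n$ (so $\mathbf{x}^i,\mathbf{y}^i\in\mathbb{R}^n$). Then $$\frac{1}{16e\,k!}\,\kappa(n)\cdot W_1(\alpha,\beta)\ \le\ SW_1(\alpha,\beta)\ \le\ \kappa(n)\cdot W_1(\alpha,\beta).$$
   Context: $\mathbb{R}^n$ carries the Euclidean metric, and $\mathbb{S}^{n-1}\subseteq\mathbb{R}^n$ is the unit sphere with its standard (unnormalized) surface measure; $S_{n-1}$ denotes its total area. For empirical measures $\alpha=\frac1k\sum_{i}\delta_{x_i}$, $\beta=\frac1k\sum_{i}\delta_{y_i}$ of size $k$ on a metric space, the $1$-Wasserstein distance is $W_1(\alpha,\beta)=\frac1k\min_\pi\sum_{i=1}^k d(x_i,y_{\pi(i)})$, with $\pi$ ranging over all bijections of $\{1,\dots,k\}$. The sliced $1$-Wasserstein distance of measures on $\mathbb{R}^n$ is $SW_1(\alpha,\beta)=\int_{\mathbb{S}^{n-1}}W_1(\theta^*_\#\alpha,\theta^*_\#\beta)\,d\theta$, where the integral is with respect to the (unnormalized) surface measure and $\theta^*_\#$ is the pushforward along the orthogonal projection onto the line spanned by $\theta$, identified with $\mathbb{R}$, i.e. $\mathbf{x}\mapsto\langle\mathbf{x},\theta\rangle$ (so $\theta^*_\#\alpha=\frac1k\sum_i\delta_{\langle\mathbf{x}^i,\theta\rangle}$).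 The constant is $\kappa(n):=\frac{2S_{n-1}}{(n-1)B(\frac{n-1}{2},\frac12)}=\int_{\mathbb{S}^{n-1}}|\mathbf{x}_1|\,d\mathbf{x}$, where $\mathbf{x}_1$ is the first coordinate of $\mathbf{x}$ and $B(a,b)=\int_0^1t^{a-1}(1-t)^{b-1}dt$ is the Beta function. $e$ is Euler's number. *)

theory Defs
  imports "HOL-Analysis.Analysis" "HOL-Combinatorics.Permutations"
begin

definition empirical :: "nat \<Rightarrow> (nat \<Rightarrow> 'a::topological_space) \<Rightarrow> 'a measure" where
  "empirical k x = distr (uniform_count_measure {1..k}) borel x"

definition matching_cost :: "nat \<Rightarrow> (nat \<Rightarrow> 'a::metric_space) \<Rightarrow> (nat \<Rightarrow> 'a) \<Rightarrow> real" where
  "matching_cost k x y =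
     1 / real k * Min ((\<lambda>\<pi>. \<Sum>i=1..k. dist (x i) (y (\<pi> i))) ` {\<pi>. \<pi> permutes {1..k}})"

text \<open>
  The value is only meaningful if both arguments are empirical measures of size \<open>k \<ge> 1\<close>; in that
  case it does not depend on the enumeration of their atoms, see \<open>W1_empirical\<close> below.
\<close>
definition W1 :: "nat \<Rightarrow> 'a::metric_space measure \<Rightarrow> 'a measure \<Rightarrow> real" where
  "W1 k \<alpha> \<beta> = (THE w. \<exists>x y. \<alpha> = empirical k x \<and> \<beta> = empirical k y \<and> w = matching_cost k x y)"

definition proj_pushforward :: "'a::euclidean_space \<Rightarrow> 'a measure \<Rightarrow> real measure" where
  "proj_pushforward \<theta> \<alpha> = distr \<alpha> borel (\<lambda>x. x \<bullet> \<theta>)"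

text \<open>
  The unnormalized surface measure on the unit sphere of an \<open>n\<close>-dimensional Euclidean space, given
  as the cone measure \<open>\<sigma>(A) = n \<cdot> \<lambda>({r u | u \<in> A, 0 < r < 1})\<close>, i.e. the measure for which Lebesgue
  measure decomposes in polar coordinates as \<open>r\<^sup>n\<^sup>-\<^sup>1 dr d\<sigma>\<close>. Note that \<open>sgn x = x / norm x\<close>.
\<close>
definition sphere_measure :: "'a::euclidean_space measure" where
  "sphere_measure = scale_measure (of_nat DIM('a))
     (distr (restrict_space lborel (ball 0 1 - {0})) (restrict_space borel (sphere 0 1)) sgn)"

definition sliced_W1 :: "nat \<Rightarrow> 'a::euclidean_space measure \<Rightarrow> 'a measure \<Rightarrow> real" where
  "sliced_W1 k \<alpha> \<beta> =
     (\<integral>\<theta>. W1 k (proj_pushforward \<theta> \<alpha>) (proj_pushforward \<theta> \<beta>) \<partial>sphere_measure)"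

definition sphere_area :: "'a::euclidean_space itself \<Rightarrow> real" where
  "sphere_area _ = measure (sphere_measure :: 'a measure) (sphere 0 1)"

text \<open>For the integral form of the Beta function see \<open>has_integral_Beta_real\<close>.\<close>
definition kappa :: "'a::euclidean_space itself \<Rightarrow> real" where
  "kappa T = 2 * sphere_area T / ((real DIM('a) - 1) * Beta ((real DIM('a) - 1) / 2) (1 / 2))"

lemma sgn_measurable_sphere:
  "sgn \<in> restrict_space lborel (ball (0::'a::euclidean_space) 1 - {0})
     \<rightarrow>\<^sub>M restrict_space borel (sphere 0 1)"
proof (rule measurable_restrict_space2)
  show "sgn \<in> space (restrict_space lborel (ball (0::'a) 1 - {0})) \<rightarrow> sphere 0 1"
    by (auto simp: space_restrict_space norm_sgn)
  have "continuous_on (ball (0::'a) 1 - {0}) sgn"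
    unfolding sgn_div_norm by (intro continuous_intros) auto
  then show "sgn \<in> borel_measurable (restrict_space lborel (ball (0::'a) 1 - {0}))"
    by (subst measurable_cong_sets[OF restrict_space_sets_cong[OF refl sets_lborel] refl])
       (rule borel_measurable_continuous_on_restrict)
qed

lemma emeasure_sphere_measure:
  fixes A :: "'a::euclidean_space set"
  assumes "A \<in> sets borel" "A \<subseteq> sphere 0 1"
  shows "emeasure sphere_measure A
    = of_nat DIM('a) * emeasure lborel {r *\<^sub>R u | r u. u \<in> A \<and> 0 < r \<and> r < 1}"
proof -
  have *: "sgn -` A \<inter> (ball 0 1 - {0}) = {r *\<^sub>R u | r u. u \<in> A \<and> 0 < r \<and> r < 1}" (is "?L = ?R")
  proof (rule set_eqI iffI)+
    fix x assume x: "x \<in> ?L"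
    then have "x = norm x *\<^sub>R sgn x" by (simp add: sgn_div_norm)
    with x show "x \<in> ?R" by (intro CollectI exI[of _ "norm x"] exI[of _ "sgn x"]) auto
  next
    fix x assume "x \<in> ?R"
    then obtain r u where ru: "x = r *\<^sub>R u" "u \<in> A" "0 < r" "r < 1" by auto
    then have "norm u = 1" using assms by auto
    with ru show "x \<in> ?L" by (auto simp: sgn_div_norm)
  qed
  have A: "A \<in> sets (restrict_space borel (sphere 0 1))"
    using assms by (simp add: sets_restrict_space_iff)
  have "{r *\<^sub>R u | r u. u \<in> A \<and> 0 < r \<and> r < 1} \<subseteq> ball 0 1 - {0}"
    unfolding *[symmetric] by blast
  then show ?thesis
    unfolding sphere_measure_def emeasure_scale_measure emeasure_distr[OF sgn_measurable_sphere A]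
    by (simp add: space_restrict_space * emeasure_restrict_space)
qed

lemma empirical_eq_imp_mset_eq:
  fixes x x' :: "nat \<Rightarrow> 'a::t1_space"
  assumes k: "k \<ge> 1" and eq: "empirical k x = empirical k x'"
  shows "image_mset x (mset_set {1..k}) = image_mset x' (mset_set {1..k})"
proof (rule multiset_eqI)
  fix a
  have *: "emeasure (empirical k z) {a} = ennreal (card {i\<in>{1..k}. z i = a} / k)"
    for z :: "nat \<Rightarrow> 'a"
  proof -
    have "z \<in> measurable (uniform_count_measure {1..k}) borel"
      by (auto simp: measurable_def space_uniform_count_measure sets_uniform_count_measure)
    then have "emeasure (empirical k z) {a} = emeasure (uniform_count_measure {1..k}) {i\<in>{1..k}. z i = a}"
      unfolding empirical_def
      by (subst emeasure_distr) (auto simp: space_uniform_count_measure intro!: arg_cong[where f="emeasure _"])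
    also have "\<dots> = ennreal (card {i\<in>{1..k}. z i = a} / k)"
      by (subst emeasure_uniform_count_measure) auto
    finally show ?thesis .
  qed
  have "card {i\<in>{1..k}. x i = a} = card {i\<in>{1..k}. x' i = a}"
    using *[of x] *[of x'] k eq by simp
  then show "count (image_mset x (mset_set {1..k})) a = count (image_mset x' (mset_set {1..k})) a"
    by (simp add: count_image_mset' eq_commute[of a])
qed

lemma matching_cost_permute:
  assumes p: "p permutes {1..k}" "\<forall>i\<in>{1..k}. x i = x' (p i)"
    and q: "q permutes {1..k}" "\<forall>i\<in>{1..k}. y i = y' (q i)"
  shows "matching_cost k x y = matching_cost k x' y'"
proof -
  let ?S = "{\<pi>. \<pi> permutes {1..k}}"
  have "(\<Sum>i=1..k. dist (x i) (y (\<pi> i))) = (\<Sum>i=1..k. dist (x' i) (y' ((q \<circ> \<pi> \<circ> inv p) i)))"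
    if "\<pi> \<in> ?S" for \<pi>
  proof -
    have "(\<Sum>i=1..k. dist (x' i) (y' ((q \<circ> \<pi> \<circ> inv p) i)))
        = (\<Sum>i=1..k. dist (x' (p i)) (y' ((q \<circ> \<pi> \<circ> inv p) (p i))))"
      using sum.permute[OF p(1), of "\<lambda>i. dist (x' i) (y' ((q \<circ> \<pi> \<circ> inv p) i))"] by (simp add: o_def)
    also have "\<dots> = (\<Sum>i=1..k. dist (x i) (y (\<pi> i)))"
    proof (intro sum.cong refl)
      fix i assume i: "i \<in> {1..k}"
      then have "\<pi> i \<in> {1..k}" using that permutes_in_image[of \<pi> "{1..k}" i] by simp
      then show "dist (x' (p i)) (y' ((q \<circ> \<pi> \<circ> inv p) (p i))) = dist (x i) (y (\<pi> i))"
        using i p(2) q(2) permutes_inverses(2)[OF p(1)] by simp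
    qed
    finally show ?thesis by simp
  qed
  then have "(\<lambda>\<pi>. \<Sum>i=1..k. dist (x i) (y (\<pi> i))) ` ?S
      = (\<lambda>\<pi>. \<Sum>i=1..k. dist (x' i) (y' (\<pi> i))) ` (\<lambda>\<pi>. q \<circ> \<pi> \<circ> inv p) ` ?S"
    unfolding image_image by (rule image_cong[OF refl])
  also have "(\<lambda>\<pi>. q \<circ> \<pi> \<circ> inv p) ` ?S = ?S"
  proof (rule set_eqI iffI)+
    fix \<pi> assume "\<pi> \<in> (\<lambda>\<pi>. q \<circ> \<pi> \<circ> inv p) ` ?S"
    then obtain \<sigma> where "\<sigma> permutes {1..k}" "\<pi> = q \<circ> \<sigma> \<circ> inv p" by blast
    then show "\<pi> \<in> ?S"
      using permutes_compose[OF permutes_inv[OF p(1)] permutes_compose[OF _ q(1)]] by simp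
  next
    fix \<pi> assume \<pi>: "\<pi> \<in> ?S"
    have "\<pi> = q \<circ> (inv q \<circ> \<pi> \<circ> p) \<circ> inv p"
      by (simp add: fun_eq_iff permutes_inverses[OF p(1)] permutes_inverses[OF q(1)])
    moreover have "inv q \<circ> \<pi> \<circ> p \<in> ?S"
      using \<pi> permutes_compose[OF p(1) permutes_compose[OF _ permutes_inv[OF q(1)]]]
      by (simp add: o_assoc)
    ultimately show "\<pi> \<in> (\<lambda>\<pi>. q \<circ> \<pi> \<circ> inv p) ` ?S" by blast
  qed
  finally show ?thesis unfolding matching_cost_def by simp
qed

lemma W1_empirical:
  assumes k: "k \<ge> 1"
  shows "W1 k (empirical k x) (empirical k y) = matching_cost k x y"
  unfolding W1_def
proof (rule the_equality)
  fix w
  assume "\<exists>x' y'. empirical k x = empirical k x' \<and> empirical k y = empirical k y'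
    \<and> w = matching_cost k x' y'"
  then obtain x' y' where eq: "empirical k x = empirical k x'" "empirical k y = empirical k y'"
    and w: "w = matching_cost k x' y'" by blast
  obtain p where "p permutes {1..k}" "\<forall>i\<in>{1..k}. x i = x' (p i)"
    using image_mset_eq_implies_permutes[OF _ empirical_eq_imp_mset_eq[OF k eq(1)]] by blast
  moreover obtain q where "q permutes {1..k}" "\<forall>i\<in>{1..k}. y i = y' (q i)"
    using image_mset_eq_implies_permutes[OF _ empirical_eq_imp_mset_eq[OF k eq(2)]] by blast
  ultimately show "w = matching_cost k x y"
    unfolding w by (rule matching_cost_permute[symmetric])
qed blast

lemma proj_pushforward_empirical:
  "proj_pushforward \<theta> (empirical k x) = empirical k (\<lambda>i. x i \<bullet> \<theta>)"
proof -
  have "x \<in> measurable (uniform_count_measure {1..k}) borel"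
    by (auto simp: measurable_def space_uniform_count_measure sets_uniform_count_measure)
  then show ?thesis
    unfolding proj_pushforward_def empirical_def by (subst distr_distr) (auto simp: o_def)
qed

end

theory Submission
  imports Defs "HOL-Probability.Distributions"
begin

text \<open>
  For functions that are positively homogeneous of degree 1, integration over the sphere agrees, up
  to the factor \<open>2 / \<Gamma>((n+1)/2)\<close>, with integration against the Gaussian weight \<open>exp (- \<bar>x\<bar>\<^sup>2)\<close>, whose
  marginals are explicit. The sliced cost of a matching \<open>\<pi>\<close> in direction \<open>x\<close> is
  \<open>f\<^sub>\<pi>(x) = \<Sum>\<^sub>i \<bar>x \<bullet> v\<^sub>i\<bar>\<close>, where \<open>v\<^sub>i\<close> is the displacement of the \<open>i\<close>-th point, and the minimum of these
  over \<open>\<pi>\<close> has to be integrated. The upper bound uses a single optimal \<open>\<pi>\<close>. For the lower bound,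
  \<open>\<epsilon> \<le> min\<^sub>\<pi> f\<^sub>\<pi> + \<epsilon> \<Sum>\<^sub>\<pi> exp (- f\<^sub>\<pi> / \<epsilon>)\<close>. By convexity of \<open>exp\<close> and boundedness of the
  Gaussian marginal density each \<open>exp (- f\<^sub>\<pi> / \<epsilon>)\<close> has integral \<open>O(\<epsilon>)\<close>, so \<open>\<epsilon>\<close> of order \<open>1 / k!\<close>
  makes the sum absorb only half of the left-hand side.
\<close>

section \<open>Lebesgue measure under translations, dilations and orthogonal maps\<close>

lemma nn_integral_lborel_translate:
  fixes f :: "'a::euclidean_space \<Rightarrow> ennreal"
  assumes [measurable]: "f \<in> borel_measurable borel"
  shows "(\<integral>\<^sup>+x. f (a + x) \<partial>lborel) = (\<integral>\<^sup>+x. f x \<partial>lborel)"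
proof -
  have "(\<integral>\<^sup>+x. f x \<partial>lborel) = (\<integral>\<^sup>+x. f x \<partial>distr lborel borel ((+) a))"
    by (simp only: lborel_distr_plus)
  also have "\<dots> = (\<integral>\<^sup>+x. f (a + x) \<partial>lborel)"
    by (rule nn_integral_distr) auto
  finally show ?thesis by simp
qed

lemma nn_integral_lborel_scaleR:
  fixes f :: "'a::euclidean_space \<Rightarrow> ennreal"
  assumes [measurable]: "f \<in> borel_measurable borel" and c: "c > 0"
  shows "(\<integral>\<^sup>+x. f x \<partial>lborel) = ennreal (c ^ DIM('a)) * (\<integral>\<^sup>+x. f (c *\<^sub>R x) \<partial>lborel)"
proof -
  have "(\<integral>\<^sup>+x. f x \<partial>lborel)
      = (\<integral>\<^sup>+x. f x \<partial>density (distr lborel borel (\<lambda>x::'a. 0 + c *\<^sub>R x)) (\<lambda>_. \<bar>c\<bar>^DIM('a)))"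
    using c by (subst lborel_affine[of c 0]) auto
  also have "\<dots> = ennreal (c ^ DIM('a)) * (\<integral>\<^sup>+x. f (c *\<^sub>R x) \<partial>lborel)"
    using c by (simp add: nn_integral_density nn_integral_distr nn_integral_cmult)
  finally show ?thesis .
qed

text \<open>
  Uniqueness of Haar measure, specialised to the pull-back along \<open>T\<close>: integrate
  \<open>1\<^bsub>B\<^esub>(x) f (T y)\<close> over both variables, \<open>B\<close> being the unit ball, which \<open>T\<close> preserves.
\<close>
lemma nn_integral_lborel_orthogonal_transformation:
  fixes f :: "'a::euclidean_space \<Rightarrow> ennreal" and T :: "'a \<Rightarrow> 'a"
  assumes T: "orthogonal_transformation T" and [measurable]: "f \<in> borel_measurable borel"
  shows "(\<integral>\<^sup>+x. f (T x) \<partial>lborel) = (\<integral>\<^sup>+x. f x \<partial>lborel)"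
proof -
  interpret T: linear T by (rule orthogonal_transformation_linear[OF T])
  have [measurable]: "T \<in> borel_measurable borel"
    using T.linear_axioms
    by (intro borel_measurable_continuous_onI linear_continuous_on) (simp add: linear_conv_bounded_linear)
  define S where "S = inv T"
  have TS: "T (S x) = x" for x
    unfolding S_def by (rule surj_f_inv_f[OF orthogonal_transformation_surj[OF T]])
  define B where "B = (\<lambda>x::'a. indicator (ball 0 1) x :: ennreal)"
  have [measurable]: "B \<in> borel_measurable borel"
    unfolding B_def by (intro borel_measurable_indicator) simp
  have BT: "B (x - T y) = B (- S x + y)" for x y
  proof -
    have "norm (x - T y) = norm (T (S x - y))" by (simp add: T.diff TS)
    also have "\<dots> = norm (- S x + y)"
      using orthogonal_transformation_norm[OF T, of "S x - y"] by (simp add: norm_minus_commute)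
    finally show ?thesis by (simp add: B_def indicator_def)
  qed
  have B: "(\<integral>\<^sup>+x. B x \<partial>lborel) = ennreal (measure lborel (ball (0::'a) 1))"
    using emeasure_lborel_ball_finite[of "0::'a" 1]
    by (simp add: B_def emeasure_eq_ennreal_measure)
  have pos: "measure lborel (ball (0::'a) 1) > 0" by (rule content_ball_pos) simp
  have "(\<integral>\<^sup>+x. B x \<partial>lborel) * (\<integral>\<^sup>+y. f (T y) \<partial>lborel)
      = (\<integral>\<^sup>+x. B x * (\<integral>\<^sup>+y. f (T y) \<partial>lborel) \<partial>lborel)"
    by (simp add: nn_integral_multc)
  \<comment> \<open>For fixed \<open>x\<close>, the variable \<open>y\<close> is translated by
    \<open>S x\<close>, which \<open>T\<close> turns into a translation of the argument of
    \<open>f\<close> by \<open>x\<close>.\<close>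
  also have "\<dots> = (\<integral>\<^sup>+x. \<integral>\<^sup>+y. B x * f (T y + x) \<partial>lborel \<partial>lborel)"
  proof (intro nn_integral_cong)
    fix x
    have "(\<integral>\<^sup>+y. f (T y) \<partial>lborel) = (\<integral>\<^sup>+y. f (T (S x + y)) \<partial>lborel)"
      by (rule nn_integral_lborel_translate[symmetric]) simp
    then show "B x * (\<integral>\<^sup>+y. f (T y) \<partial>lborel) = (\<integral>\<^sup>+y. B x * f (T y + x) \<partial>lborel)"
      by (simp add: nn_integral_cmult T.add TS add.commute)
  qed
  also have "\<dots> = (\<integral>\<^sup>+y. \<integral>\<^sup>+x. B x * f (T y + x) \<partial>lborel \<partial>lborel)"
    by (rule lborel_pair.Fubini'[symmetric]) simp
  also have "\<dots> = (\<integral>\<^sup>+y. \<integral>\<^sup>+x. B (x - T y) * f x \<partial>lborel \<partial>lborel)"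
  proof (rule nn_integral_cong)
    fix y
    show "(\<integral>\<^sup>+x. B x * f (T y + x) \<partial>lborel) = (\<integral>\<^sup>+x. B (x - T y) * f x \<partial>lborel)"
      using nn_integral_lborel_translate[of "\<lambda>x. B (x - T y) * f x" "T y"] by simp
  qed
  also have "\<dots> = (\<integral>\<^sup>+x. \<integral>\<^sup>+y. B (x - T y) * f x \<partial>lborel \<partial>lborel)"
    by (rule lborel_pair.Fubini') simp
  also have "\<dots> = (\<integral>\<^sup>+x. (\<integral>\<^sup>+y. B y \<partial>lborel) * f x \<partial>lborel)"
    \<comment> \<open>Since \<open>T\<close> is an isometry, the indicator can be read as a
      translate in \<open>y\<close>, and its integral no longer depends on \<open>x\<close>.\<close>
    unfolding BT
  proof (rule nn_integral_cong)
    fix x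
    have "(\<integral>\<^sup>+y. B (- S x + y) \<partial>lborel) = (\<integral>\<^sup>+y. B y \<partial>lborel)"
      by (rule nn_integral_lborel_translate) measurable
    then show "(\<integral>\<^sup>+y. B (- S x + y) * f x \<partial>lborel) = (\<integral>\<^sup>+y. B y \<partial>lborel) * f x"
      by (subst nn_integral_multc) simp_all
  qed
  also have "\<dots> = (\<integral>\<^sup>+y. B y \<partial>lborel) * (\<integral>\<^sup>+x. f x \<partial>lborel)"
    by (simp add: nn_integral_cmult)
  \<comment> \<open>The volume of the unit ball is positive and finite, so it cancels.\<close>
  finally show ?thesis
    unfolding B using pos by (subst (asm) ennreal_mult_cancel_left) auto
qed

section \<open>Homogeneous functions: from balls to the Gaussian weight\<close>

text \<open>Used with \<open>a\<close> a squared norm: it writes the Gaussian weight as a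
  superposition of indicators of centred balls.\<close>

lemma nn_integral_exp_tail: "(\<integral>\<^sup>+t. ennreal (exp (- t)) * indicator {a<..} t \<partial>lborel) = ennreal (exp (- a))"
proof -
  have "(\<integral>\<^sup>+t. ennreal (exp (- t)) * indicator {a<..} t \<partial>lborel)
      = (\<integral>\<^sup>+t. ennreal (exp (- t)) * indicator {a..} t \<partial>lborel)"
    by (intro nn_integral_cong_AE, use AE_lborel_singleton[of a] in eventually_elim)
       (auto split: split_indicator)
  also have "\<dots> = ennreal (0 - (- exp (- a)))"
  proof (rule nn_integral_FTC_atLeast)
    have "((\<lambda>x::real. - exp (- x)) \<longlongrightarrow> - 0) at_top"
      by (intro tendsto_minus filterlim_compose[OF exp_at_bot] filterlim_uminus_at_bot_at_top)
    then show "((\<lambda>x::real. - exp (- x)) \<longlongrightarrow> 0) at_top" by simp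
  qed (auto intro!: derivative_eq_intros)
  finally show ?thesis by simp
qed

text \<open>Substitution of \<open>s *\<^sub>R x\<close> for \<open>x\<close>: the volume element
  contributes the exponent \<open>DIM('a)\<close>, the homogeneity of \<open>f\<close> the exponent
  \<open>d\<close>.\<close>

lemma nn_integral_ball_homogeneous:
  fixes f :: "'a::euclidean_space \<Rightarrow> ennreal"
  assumes [measurable]: "f \<in> borel_measurable borel"
    and hom: "\<And>r x. r > 0 \<Longrightarrow> f (r *\<^sub>R x) = ennreal (r ^ d) * f x" and s: "s > 0"
  shows "(\<integral>\<^sup>+x. f x * indicator (ball 0 s) x \<partial>lborel)
    = ennreal (s ^ (DIM('a) + d)) * (\<integral>\<^sup>+x. f x * indicator (ball 0 1) x \<partial>lborel)"
proof -
  have ind: "indicator (ball 0 s) (s *\<^sub>R x) = (indicator (ball 0 1) x :: ennreal)" for x :: 'a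
    using s by (auto simp: indicator_def)
  have meas: "(\<lambda>x. f x * indicator (ball 0 r) x) \<in> borel_measurable borel" for r
    by (intro borel_measurable_times_ennreal borel_measurable_indicator assms) simp
  then have meas1: "(\<lambda>x. f x * indicator (ball 0 1) x) \<in> borel_measurable lborel" by simp
  have "(\<integral>\<^sup>+x. f x * indicator (ball 0 s) x \<partial>lborel)
      = ennreal (s ^ DIM('a)) * (\<integral>\<^sup>+x. ennreal (s ^ d) * (f x * indicator (ball 0 1) x) \<partial>lborel)"
    by (subst nn_integral_lborel_scaleR[OF meas s]) (simp add: hom[OF s] ind mult.assoc)
  also have "\<dots> = ennreal (s ^ (DIM('a) + d)) * (\<integral>\<^sup>+x. f x * indicator (ball 0 1) x \<partial>lborel)"
    using s by (subst nn_integral_cmult[OF meas1]) (simp add: power_add ennreal_mult mult.assoc)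
  finally show ?thesis .
qed

text \<open>Layer-cake argument: after expanding the weight by \<open>nn_integral_exp_tail\<close>
  and swapping the integrals, the inner one runs over the ball of radius \<open>sqrt t\<close> and
  scales like \<open>t\<close> to the power \<open>(DIM('a) + d) / 2\<close>. What remains is a
  Gamma integral.\<close>

lemma nn_integral_gaussian_homogeneous:
  fixes f :: "'a::euclidean_space \<Rightarrow> ennreal"
  assumes [measurable]: "f \<in> borel_measurable borel"
    and hom: "\<And>r x. r > 0 \<Longrightarrow> f (r *\<^sub>R x) = ennreal (r ^ d) * f x"
  shows "(\<integral>\<^sup>+x. f x * ennreal (exp (- (norm x)\<^sup>2)) \<partial>lborel)
    = ennreal (Gamma (real (DIM('a) + d) / 2 + 1)) * (\<integral>\<^sup>+x. f x * indicator (ball 0 1) x \<partial>lborel)"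
proof -
  let ?n = "DIM('a) + d" and ?G = "\<integral>\<^sup>+x. f x * indicator (ball 0 1) x \<partial>lborel"
  have "(\<integral>\<^sup>+x. f x * ennreal (exp (- (norm x)\<^sup>2)) \<partial>lborel)
      = (\<integral>\<^sup>+x. \<integral>\<^sup>+t. f x * (ennreal (exp (- t)) * (if (norm x)\<^sup>2 < t then 1 else 0)) \<partial>lborel \<partial>lborel)"
    by (intro nn_integral_cong, subst nn_integral_exp_tail[symmetric], subst nn_integral_cmult[symmetric])
       (auto intro!: nn_integral_cong simp: indicator_def)
  also have "\<dots> = (\<integral>\<^sup>+t. \<integral>\<^sup>+x. f x * (ennreal (exp (- t)) * (if (norm x)\<^sup>2 < t then 1 else 0)) \<partial>lborel \<partial>lborel)"
    by (rule lborel_pair.Fubini') simp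
  \<comment> \<open>The exponent keeps the shape \<open>z - 1\<close> so that it matches the
    integrand of \<open>Gamma_conv_nn_integral_real\<close>.\<close>
  also have "\<dots> = (\<integral>\<^sup>+t. ennreal (indicator {0..} t * t powr (real ?n / 2 + 1 - 1) / exp t) * ?G \<partial>lborel)"
  \<comment> \<open>The point \<open>t = 0\<close> is discarded as a null set; for
    \<open>t < 0\<close> both sides vanish.\<close>
  proof (intro nn_integral_cong_AE, use AE_lborel_singleton[of "0::real"] in eventually_elim)
    fix t :: real assume t0: "t \<noteq> 0"
    show "(\<integral>\<^sup>+x. f x * (ennreal (exp (- t)) * (if (norm x)\<^sup>2 < t then 1 else 0)) \<partial>lborel)
        = ennreal (indicator {0..} t * t powr (real ?n / 2 + 1 - 1) / exp t) * ?G"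
    proof (cases "t > 0")
      case True
      have iff: "(norm x)\<^sup>2 < t \<longleftrightarrow> norm x < sqrt t" for x :: 'a
        using True by (metis real_less_rsqrt real_sqrt_less_iff real_sqrt_abs abs_norm_cancel)
      have "(\<integral>\<^sup>+x. f x * (ennreal (exp (- t)) * (if (norm x)\<^sup>2 < t then 1 else 0)) \<partial>lborel)
          = (\<integral>\<^sup>+x. ennreal (exp (- t)) * (f x * indicator (ball 0 (sqrt t)) x) \<partial>lborel)"
        by (intro nn_integral_cong) (auto simp: iff indicator_def mult_ac)
      also have "\<dots> = ennreal (exp (- t)) * (ennreal (sqrt t ^ ?n) * ?G)"
        using True nn_integral_ball_homogeneous[OF assms(1) hom, of "sqrt t"]
        by (subst nn_integral_cmult)
          (simp_all add: borel_measurable_times_ennreal borel_measurable_indicator)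
      also have "sqrt t ^ ?n = t powr (real ?n / 2)"
        using True by (simp add: powr_half_sqrt[symmetric] powr_powr powr_realpow[symmetric])
      also have "ennreal (exp (- t)) * (ennreal (t powr (real ?n / 2)) * ?G)
          = ennreal (exp (- t) * t powr (real ?n / 2)) * ?G"
        by (simp only: ennreal_mult[OF exp_ge_zero powr_ge_zero] mult.assoc)
      also have "exp (- t) * t powr (real ?n / 2)
          = indicator {0..} t * t powr (real ?n / 2 + 1 - 1) / exp t"
        using True by (simp add: exp_minus field_simps)
      finally show ?thesis .
    next
      case False
      then have "\<not> (norm x)\<^sup>2 < t" for x :: 'a by (smt (verit) zero_le_power2)
      then show ?thesis using False t0 by simp
    qed
  qed
  also have "\<dots> = ennreal (Gamma (real ?n / 2 + 1)) * ?G"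
    by (subst nn_integral_multc) (simp_all only: Gamma_conv_nn_integral_real, simp_all)
  finally show ?thesis .
qed

section \<open>Integration over the sphere and the constant \<open>kappa\<close>\<close>

lemma nn_integral_sphere_measure:
  fixes h :: "'a::euclidean_space \<Rightarrow> ennreal"
  assumes [measurable]: "h \<in> borel_measurable borel"
  shows "(\<integral>\<^sup>+\<theta>. h \<theta> \<partial>sphere_measure)
    = of_nat DIM('a) * (\<integral>\<^sup>+x. h (sgn x) * indicator (ball 0 1) x \<partial>lborel)"
proof -
  have h: "h \<in> borel_measurable (restrict_space borel (sphere 0 1))"
    by (rule measurable_restrict_space1) simp
  have "(\<integral>\<^sup>+\<theta>. h \<theta> \<partial>sphere_measure)
      = of_nat DIM('a) * (\<integral>\<^sup>+x. h (sgn x) * indicator (ball 0 1 - {0}) x \<partial>lborel)"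
    unfolding sphere_measure_def
    using h by (simp add: nn_integral_scale_measure nn_integral_distr[OF sgn_measurable_sphere]
        nn_integral_restrict_space)
  also have "(\<integral>\<^sup>+x. h (sgn x) * indicator (ball 0 1 - {0}) x \<partial>lborel)
      = (\<integral>\<^sup>+x. h (sgn x) * indicator (ball 0 1) x \<partial>lborel)"
    by (intro nn_integral_cong_AE, use AE_lborel_singleton[of "0::'a"] in eventually_elim)
       (auto simp: indicator_def)
  finally show ?thesis .
qed

text \<open>The classical relation between area and volume. It evaluates \<open>sphere_area\<close>
  and also supplies finiteness of the surface measure.\<close>

lemma emeasure_sphere_measure_sphere:
  "emeasure (sphere_measure :: 'a::euclidean_space measure) (sphere 0 1)
    = ennreal (real DIM('a) * unit_ball_vol (real DIM('a)))"
proof -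
  have "sphere 0 1 \<in> sets (sphere_measure :: 'a measure)"
    by (simp add: sphere_measure_def sets_restrict_space_iff)
  then have "emeasure (sphere_measure :: 'a measure) (sphere 0 1)
      = (\<integral>\<^sup>+\<theta>. indicator (sphere (0::'a) 1) \<theta> \<partial>sphere_measure)"
    by simp
  also have "\<dots> = of_nat DIM('a) * (\<integral>\<^sup>+x. indicator (sphere (0::'a) 1) (sgn x) * indicator (ball 0 1) x \<partial>lborel)"
    by (intro nn_integral_sphere_measure borel_measurable_indicator) simp
  also have "(\<integral>\<^sup>+x. indicator (sphere (0::'a) 1) (sgn x) * indicator (ball 0 1) x \<partial>lborel)
      = (\<integral>\<^sup>+x. indicator (ball (0::'a) 1) x \<partial>lborel)"
    by (intro nn_integral_cong_AE, use AE_lborel_singleton[of "0::'a"] in eventually_elim)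
       (auto simp: indicator_def norm_sgn)
  also have "\<dots> = ennreal (unit_ball_vol (real DIM('a)))"
    by (simp add: emeasure_ball)
  finally show ?thesis
    by (simp add: ennreal_mult ennreal_of_nat_eq_real_of_nat)
qed

text \<open>This is the form in which the constant arises below: the factor that converts Gaussian
  integrals into sphere integrals, times the Gaussian integral of
  \<open>\<bar>x \<bullet> u\<bar>\<close> for a unit vector \<open>u\<close>.\<close>

lemma kappa_eq:
  assumes "DIM('a::euclidean_space) \<ge> 2"
  shows "kappa TYPE('a) = 2 / Gamma ((real DIM('a) + 1) / 2) * sqrt pi ^ (DIM('a) - 1)"
proof -
  define n where "n = real DIM('a)"
  have n: "n \<ge> 2" using assms by (simp add: n_def)
  have area: "sphere_area TYPE('a) = n * (pi powr (n / 2) / Gamma (n / 2 + 1))"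
    unfolding sphere_area_def measure_def emeasure_sphere_measure_sphere
    by (simp add: unit_ball_vol_def n_def enn2real_ennreal Gamma_real_nonneg)
  have G1: "Gamma (n / 2 + 1) = n / 2 * Gamma (n / 2)"
    using n by (intro Gamma_plus1) (auto elim!: nonpos_Ints_cases)
  have "Gamma ((n - 1) / 2 + 1) = (n - 1) / 2 * Gamma ((n - 1) / 2)"
    using n by (intro Gamma_plus1) (auto elim!: nonpos_Ints_cases)
  then have G2: "Gamma ((n + 1) / 2) = (n - 1) / 2 * Gamma ((n - 1) / 2)"
    by (simp add: field_simps)
  have B: "Beta ((n - 1) / 2) (1 / 2) = Gamma ((n - 1) / 2) * sqrt pi / Gamma (n / 2)"
    by (simp add: Beta_def Gamma_one_half_real add_divide_distrib[symmetric])
  have pos: "Gamma ((n - 1) / 2) > 0" "Gamma (n / 2) > 0"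
    using n by (auto intro!: Gamma_real_pos)
  have "pi powr (n / 2) = sqrt pi ^ DIM('a)"
    by (simp add: n_def powr_half_sqrt[symmetric] powr_powr powr_realpow[symmetric])
  also have "\<dots> = sqrt pi * sqrt pi ^ (DIM('a) - 1)"
    using assms by (metis not_numeral_le_zero power_eq_if)
  finally have P: "pi powr (n / 2) = sqrt pi * sqrt pi ^ (DIM('a) - 1)" .
  \<comment> \<open>The remaining identity is purely rational once \<open>s\<close> stands for
    \<open>sqrt pi\<close>, \<open>p\<close> for its power, and \<open>a\<close>, \<open>d\<close>
    for the Gamma values at \<open>n / 2\<close> and \<open>(n - 1) / 2\<close>.\<close>
  have "2 * (n * (s * p / (n / 2 * a))) / ((n - 1) * (d * s / a)) = 2 / ((n - 1) / 2 * d) * p"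
    if "s > 0" "a > 0" "d > 0" for s a d p :: real
    using that n by (simp add: divide_simps)
  then show ?thesis
    unfolding kappa_def n_def[symmetric] area B G1 G2 P
    using pos by simp
qed

text \<open>Both sides are compared with integrals over the unit ball. The sphere integral is
  \<open>n * F\<close> with \<open>F\<close> the ball integral of the radially constant extension
  \<open>g\<close> of \<open>h\<close>; the Gaussian one is a Gamma multiple of the ball integral
  \<open>G\<close> of \<open>h\<close> itself. The link is
  \<open>n * F = (n + 1) * G\<close>.\<close>

lemma nn_integral_sphere_measure_eq_gaussian:
  fixes h :: "'a::euclidean_space \<Rightarrow> ennreal"
  assumes [measurable]: "h \<in> borel_measurable borel"
    and hom: "\<And>r x. r > 0 \<Longrightarrow> h (r *\<^sub>R x) = ennreal r * h x"
    and fin: "(\<integral>\<^sup>+\<theta>. h \<theta> \<partial>sphere_measure) < \<infinity>"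
  shows "(\<integral>\<^sup>+\<theta>. h \<theta> \<partial>sphere_measure) = ennreal (2 / Gamma ((real DIM('a) + 1) / 2))
    * (\<integral>\<^sup>+x. h x * ennreal (exp (- (norm x)\<^sup>2)) \<partial>lborel)"
proof -
  define n where "n = DIM('a)"
  have n: "n > 0" by (simp add: n_def)
  define g where "g = (\<lambda>x. h (sgn x))"
  have g_eq: "g = (\<lambda>x. h (x /\<^sub>R norm x))" by (simp add: g_def sgn_div_norm[abs_def])
  have [measurable]: "g \<in> borel_measurable borel" unfolding g_eq by measurable
  have [measurable]: "(\<lambda>x::'a. indicator (ball 0 1) x :: ennreal) \<in> borel_measurable borel"
    by (intro borel_measurable_indicator) simp
  have g_hom: "g (r *\<^sub>R x) = ennreal (r ^ 0) * g x" if "r > 0" for r x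
    using that by (simp add: g_def sgn_scaleR)
  have hg: "h x = ennreal (norm x) * g x" if "x \<noteq> 0" for x
    using hom[of "norm x" "sgn x"] that by (simp add: g_def sgn_div_norm)
  define F where "F = (\<integral>\<^sup>+x. g x * indicator (ball 0 1) x \<partial>lborel)"
  define G where "G = (\<integral>\<^sup>+x. h x * indicator (ball 0 1) x \<partial>lborel)"
  define K where "K = (\<integral>\<^sup>+x. g x * ennreal (1 - norm x) * indicator (ball 0 1) x \<partial>lborel)"
  have sph: "(\<integral>\<^sup>+\<theta>. h \<theta> \<partial>sphere_measure) = of_nat n * F"
    unfolding F_def g_def n_def by (rule nn_integral_sphere_measure) simp
  \<comment> \<open>Inside the ball, \<open>g\<close> is split by the weights \<open>norm x\<close>
    and \<open>1 - norm x\<close>; the first part is \<open>h\<close> away from the origin.\<close>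
  have "F = (\<integral>\<^sup>+x. h x * indicator (ball 0 1) x + g x * ennreal (1 - norm x) * indicator (ball 0 1) x \<partial>lborel)"
    unfolding F_def
  proof (intro nn_integral_cong_AE, use AE_lborel_singleton[of "0::'a"] in eventually_elim)
    fix x :: 'a assume "x \<noteq> 0"
    moreover have "g x = ennreal (norm x) * g x + g x * ennreal (1 - norm x)" if "norm x < 1"
      using that by (simp add: mult.commute distrib_left[symmetric] ennreal_plus[symmetric] del: ennreal_plus)
    ultimately show "g x * indicator (ball 0 1) x
        = h x * indicator (ball 0 1) x + g x * ennreal (1 - norm x) * indicator (ball 0 1) x"
      by (auto simp: hg indicator_def)
  qed
  also have "\<dots> = G + K"
    unfolding G_def K_def by (rule nn_integral_add) measurable
  finally have FGK: "F = G + K" .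
  \<comment> \<open>The weight \<open>1 - norm x\<close> is the length of the set of radii
    \<open>s\<close> with \<open>norm x < s \<le> 1\<close>, so \<open>K\<close> averages integrals
    of \<open>g\<close> over balls of radius \<open>s\<close>, each equal to
    \<open>s ^ n * F\<close>.\<close>
  have "K = (\<integral>\<^sup>+x. \<integral>\<^sup>+s. g x * (if norm x < s \<and> s \<le> 1 then 1 else 0) \<partial>lborel \<partial>lborel)"
    unfolding K_def
  proof (intro nn_integral_cong)
    fix x :: 'a
    have "(\<integral>\<^sup>+s. (if norm x < s \<and> s \<le> 1 then 1 else 0) \<partial>lborel) = (\<integral>\<^sup>+s. indicator {norm x<..1} s \<partial>lborel)"
      by (intro nn_integral_cong) (auto simp: indicator_def)
    also have "\<dots> = ennreal (1 - norm x) * indicator (ball 0 1) x"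
      by (cases "norm x < 1") simp_all
    finally have len: "(\<integral>\<^sup>+s. (if norm x < s \<and> s \<le> 1 then 1 else 0) \<partial>lborel)
        = ennreal (1 - norm x) * indicator (ball 0 1) x" .
    show "g x * ennreal (1 - norm x) * indicator (ball 0 1) x
        = (\<integral>\<^sup>+s. g x * (if norm x < s \<and> s \<le> 1 then 1 else 0) \<partial>lborel)"
      by (subst nn_integral_cmult) (auto simp only: len mult.assoc, measurable)
  qed
  also have "\<dots> = (\<integral>\<^sup>+s. \<integral>\<^sup>+x. g x * (if norm x < s \<and> s \<le> 1 then 1 else 0) \<partial>lborel \<partial>lborel)"
    by (rule lborel_pair.Fubini') simp
  also have "\<dots> = (\<integral>\<^sup>+s. ennreal (s ^ n) * indicator {0..1} s * F \<partial>lborel)"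
  proof (intro nn_integral_cong)
    fix s :: real
    consider "0 < s" "s \<le> 1" | "s \<le> 0" | "s > 1" by linarith
    then show "(\<integral>\<^sup>+x. g x * (if norm x < s \<and> s \<le> 1 then 1 else 0) \<partial>lborel)
        = ennreal (s ^ n) * indicator {0..1} s * F"
    proof cases
      case 1
      then have "(\<integral>\<^sup>+x. g x * (if norm x < s \<and> s \<le> 1 then 1 else 0) \<partial>lborel)
          = (\<integral>\<^sup>+x. g x * indicator (ball 0 s) x \<partial>lborel)"
        by (intro nn_integral_cong) (auto simp: indicator_def)
      also have "\<dots> = ennreal (s ^ n) * F"
        unfolding F_def n_def using nn_integral_ball_homogeneous[of g 0 s] g_hom 1 by simp
      finally show ?thesis using 1 by simp
    next
      case 2
      then have "\<not> norm x < s" for x :: 'a using norm_ge_zero[of x] by linarith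
      \<comment> \<open>The endpoint \<open>s = 0\<close> lies in \<open>{0..1}\<close>; there
        \<open>s ^ n\<close> vanishes because \<open>n > 0\<close>.\<close>
      then show ?thesis using 2 n by (auto simp: indicator_def)
    qed auto
  qed
  also have "\<dots> = (\<integral>\<^sup>+s. ennreal (s ^ n) * indicator {0..1} s \<partial>lborel) * F"
    by (rule nn_integral_multc) measurable
  also have "(\<integral>\<^sup>+s. ennreal (s ^ n) * indicator {0..1} s \<partial>lborel)
      = ennreal (1 ^ Suc n / real (Suc n) - 0 ^ Suc n / real (Suc n))"
    by (rule nn_integral_FTC_Icc) (auto intro!: derivative_eq_intros simp del: of_nat_Suc power_Suc)
  finally have K: "K = ennreal (1 / (real n + 1)) * F" by (simp add: add.commute)
  \<comment> \<open>Finiteness allows \<open>F = G + F / (n + 1)\<close> to be solved in the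
    reals.\<close>
  have "F < \<infinity>" using fin n unfolding sph by (auto simp: ennreal_mult_less_top)
  then obtain a where a: "F = ennreal a" "a \<ge> 0" by (cases F) auto
  have "G < \<infinity>" using \<open>F < \<infinity>\<close> unfolding FGK by (auto simp: less_top[symmetric])
  then obtain b where b: "G = ennreal b" "b \<ge> 0" by (cases G) auto
  have "ennreal a = ennreal (b + a / (real n + 1))"
    using FGK K a b by (simp add: ennreal_mult[symmetric] ennreal_plus[symmetric] del: ennreal_plus)
  then have "a = b + a / (real n + 1)"
    using a b by (subst (asm) ennreal_inj) auto
  then have ab: "real n * a = (real n + 1) * b" by (simp add: field_simps)
  define \<gamma> where "\<gamma> = Gamma ((real n + 1) / 2)"
  have \<gamma>: "\<gamma> > 0" unfolding \<gamma>_def by (intro Gamma_real_pos) simp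
  have "(real n + 1) / 2 \<notin> \<int>\<^sub>\<le>\<^sub>0" by (auto elim!: nonpos_Ints_cases)
  then have "Gamma ((real n + 1) / 2 + 1) = (real n + 1) / 2 * \<gamma>"
    unfolding \<gamma>_def by (rule Gamma_plus1)
  moreover have "(\<integral>\<^sup>+x. h x * ennreal (exp (- (norm x)\<^sup>2)) \<partial>lborel)
      = ennreal (Gamma ((real n + 1) / 2 + 1)) * G"
    unfolding G_def n_def using nn_integral_gaussian_homogeneous[of h 1] hom by (simp add: add.commute)
  ultimately have "(\<integral>\<^sup>+x. h x * ennreal (exp (- (norm x)\<^sup>2)) \<partial>lborel) = ennreal ((real n + 1) / 2 * \<gamma>) * G"
    by (simp only:)
  then have "ennreal (2 / \<gamma>) * (\<integral>\<^sup>+x. h x * ennreal (exp (- (norm x)\<^sup>2)) \<partial>lborel)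
      = ennreal (2 / \<gamma> * ((real n + 1) / 2 * \<gamma> * b))"
    using b \<gamma> by (simp add: ennreal_mult[symmetric])
  also have "2 / \<gamma> * ((real n + 1) / 2 * \<gamma> * b) = (real n + 1) * b"
    using \<gamma> by (simp add: field_simps)
  also have "ennreal ((real n + 1) * b) = of_nat n * F"
    using a by (simp add: ab[symmetric] ennreal_mult ennreal_of_nat_eq_real_of_nat)
  finally show ?thesis unfolding sph \<gamma>_def n_def by simp
qed

section \<open>One-dimensional Gaussian integrals\<close>

lemma nn_integral_exp_neg_square: "(\<integral>\<^sup>+t. ennreal (exp (- t\<^sup>2)) \<partial>lborel) = ennreal (sqrt pi)"
proof -
  have "has_bochner_integral lborel (\<lambda>t::real. exp (- t\<^sup>2)) (2 *\<^sub>R (sqrt pi / 2))"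
    by (rule has_bochner_integral_even_function[OF gaussian_moment_0]) simp
  then show ?thesis
    by (subst nn_integral_eq_integral) (auto simp: has_bochner_integral_iff)
qed

text \<open>Because this moment is \<open>1\<close>, the direction being measured contributes no
  factor \<open>sqrt pi\<close>; hence the exponent \<open>CARD('n) - 1\<close> below.\<close>

lemma nn_integral_abs_exp_neg_square: "(\<integral>\<^sup>+t. ennreal (\<bar>t\<bar> * exp (- t\<^sup>2)) \<partial>lborel) = 1"
proof -
  have "has_bochner_integral lborel (\<lambda>t::real. indicator {0..} t *\<^sub>R (exp (- t\<^sup>2) * \<bar>t\<bar>)) (1 / 2)"
    by (rule has_bochner_integral_cong[THEN iffD1, OF _ _ _ gaussian_moment_1])
       (auto simp: indicator_def)
  then have "has_bochner_integral lborel (\<lambda>t::real. exp (- t\<^sup>2) * \<bar>t\<bar>) (2 *\<^sub>R (1 / 2))"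
    by (rule has_bochner_integral_even_function) simp
  then show ?thesis
    by (subst nn_integral_eq_integral) (auto simp: has_bochner_integral_iff mult.commute)
qed

text \<open>The Gaussian factor is at most \<open>1\<close>; dropping it leaves a two-sided
  exponential integral. The decay in \<open>c\<close> is what the lower bound relies on.\<close>

lemma nn_integral_exp_neg_abs_gaussian_le:
  assumes c: "c > 0"
  shows "(\<integral>\<^sup>+t. ennreal (exp (- c * \<bar>t\<bar>) * exp (- t\<^sup>2)) \<partial>lborel) \<le> ennreal (2 / c)"
proof -
  have half: "(\<integral>\<^sup>+t. ennreal (exp (- c * t)) * indicator {0..} t \<partial>lborel) = ennreal (1 / c)"
  proof -
    have "(\<integral>\<^sup>+t. ennreal (exp (- c * t)) * indicator {0..} t \<partial>lborel) = ennreal (0 - (- exp (- c * 0) / c))"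
    proof (rule nn_integral_FTC_atLeast)
      have "LIM x at_top. - c * x :> at_bot"
        using c by (intro filterlim_tendsto_neg_mult_at_bot[OF tendsto_const] filterlim_ident) auto
      then have "((\<lambda>x::real. - exp (- c * x) / c) \<longlongrightarrow> - 0 / c) at_top"
        by (intro tendsto_divide tendsto_minus filterlim_compose[OF exp_at_bot]) (use c in auto)
      then show "((\<lambda>x::real. - exp (- c * x) / c) \<longlongrightarrow> 0) at_top" by simp
    qed (use c in \<open>auto intro!: derivative_eq_intros\<close>)
    then show ?thesis by simp
  qed
  have half': "(\<integral>\<^sup>+t. ennreal (exp (c * t)) * indicator {..0} t \<partial>lborel) = ennreal (1 / c)"
    unfolding half[symmetric]
    by (subst nn_integral_real_affine[where c="-1" and t=0]) (auto intro!: nn_integral_cong simp: indicator_def)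
  have "(\<integral>\<^sup>+t. ennreal (exp (- c * \<bar>t\<bar>) * exp (- t\<^sup>2)) \<partial>lborel)
      \<le> (\<integral>\<^sup>+t. ennreal (exp (- c * t)) * indicator {0..} t + ennreal (exp (c * t)) * indicator {..0} t \<partial>lborel)"
  proof (intro nn_integral_mono)
    fix t :: real
    have "exp (- c * \<bar>t\<bar>) * exp (- t\<^sup>2) \<le> exp (- c * \<bar>t\<bar>)" by (simp add: mult_le_cancel_left1)
    then have "ennreal (exp (- c * \<bar>t\<bar>) * exp (- t\<^sup>2)) \<le> ennreal (exp (- c * \<bar>t\<bar>))"
      by (rule ennreal_leI)
    \<comment> \<open>At \<open>t = 0\<close> both indicators are \<open>1\<close>; the overlap only
      enlarges the upper bound.\<close>
    also have "\<dots> \<le> ennreal (exp (- c * t)) * indicator {0..} t + ennreal (exp (c * t)) * indicator {..0} t"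
      by (cases "t = 0"; cases "t > 0") (auto simp: indicator_def)
    finally show "ennreal (exp (- c * \<bar>t\<bar>) * exp (- t\<^sup>2))
        \<le> ennreal (exp (- c * t)) * indicator {0..} t + ennreal (exp (c * t)) * indicator {..0} t" .
  qed
  also have "\<dots> = ennreal (1 / c) + ennreal (1 / c)"
    by (subst nn_integral_add) (auto simp only: half half', measurable)
  also have "\<dots> = ennreal (2 / c)"
    using c by (simp add: ennreal_plus[symmetric] del: ennreal_plus)
  finally show ?thesis .
qed

section \<open>Gaussian integrals of functions of inner products\<close>

text \<open>An orthogonal map \<open>T\<close> carrying a basis vector \<open>b\<close> to
  \<open>u\<close> preserves both Lebesgue measure and the weight. After it, the integrand is a
  product over coordinates: \<open>F\<close> enters only at \<open>b\<close>, and every other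
  coordinate gives \<open>sqrt pi\<close>.\<close>

lemma nn_integral_gaussian_inner:
  fixes u :: "real ^ 'n" and F :: "real \<Rightarrow> ennreal"
  assumes u: "norm u = 1" and [measurable]: "F \<in> borel_measurable borel"
  shows "(\<integral>\<^sup>+x. F (x \<bullet> u) * ennreal (exp (- (norm x)\<^sup>2)) \<partial>lborel)
    = ennreal (sqrt pi ^ (CARD('n) - 1)) * (\<integral>\<^sup>+t. F t * ennreal (exp (- t\<^sup>2)) \<partial>lborel)"
proof -
  obtain b :: "real ^ 'n" where b: "b \<in> Basis" using nonempty_Basis by blast
  obtain T where T: "orthogonal_transformation T" "T b = u"
    using orthogonal_transformation_exists[of b u] u b by auto
  have Tb: "T x \<bullet> u = x \<bullet> b" for x
    using T by (auto simp: orthogonal_transformation_def)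
  let ?f = "\<lambda>c t. (if c = b then F t else 1) * ennreal (exp (- t\<^sup>2))"
  have "(\<integral>\<^sup>+x. F (x \<bullet> u) * ennreal (exp (- (norm x)\<^sup>2)) \<partial>lborel)
      = (\<integral>\<^sup>+x. F (T x \<bullet> u) * ennreal (exp (- (norm (T x))\<^sup>2)) \<partial>lborel)"
    by (rule nn_integral_lborel_orthogonal_transformation[OF T(1), symmetric]) simp
  also have "\<dots> = (\<integral>\<^sup>+x. (\<Prod>c\<in>Basis. ?f c (x \<bullet> c)) \<partial>lborel)"
  proof (intro nn_integral_cong)
    fix x :: "real ^ 'n"
    have "(norm (T x))\<^sup>2 = (\<Sum>c\<in>Basis. (x \<bullet> c)\<^sup>2)"
      unfolding orthogonal_transformation_norm[OF T(1)] power2_norm_eq_inner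
      by (subst euclidean_inner) (simp add: power2_eq_square)
    then have "ennreal (exp (- (norm (T x))\<^sup>2)) = (\<Prod>c\<in>Basis. ennreal (exp (- (x \<bullet> c)\<^sup>2)))"
      by (simp add: prod_ennreal exp_sum[symmetric] sum_negf)
    then show "F (T x \<bullet> u) * ennreal (exp (- (norm (T x))\<^sup>2)) = (\<Prod>c\<in>Basis. ?f c (x \<bullet> c))"
      using b by (simp add: Tb prod.distrib prod.delta)
  qed
  also have "\<dots> = (\<Prod>c\<in>Basis. \<integral>\<^sup>+t. ?f c t \<partial>lborel)"
    by (rule nn_integral_lborel_prod) auto
  also have "\<dots> = (\<integral>\<^sup>+t. ?f b t \<partial>lborel) * (\<Prod>c\<in>Basis - {b}. \<integral>\<^sup>+t. ?f c t \<partial>lborel)"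
    by (rule prod.remove) (use b in auto)
  also have "(\<Prod>c\<in>Basis - {b}. \<integral>\<^sup>+t. ?f c t \<partial>lborel) = (\<Prod>c\<in>Basis - {b}. ennreal (sqrt pi))"
    by (intro prod.cong refl) (auto simp: nn_integral_exp_neg_square)
  also have "\<dots> = ennreal (sqrt pi ^ (CARD('n) - 1))"
    using b by (simp add: card_Diff_singleton ennreal_power)
  finally show ?thesis by (simp add: mult.commute)
qed

lemma nn_integral_gaussian_vec:
  "(\<integral>\<^sup>+x. ennreal (exp (- (norm (x :: real ^ 'n))\<^sup>2)) \<partial>lborel) = ennreal (sqrt pi ^ CARD('n))"
proof -
  obtain b :: "real ^ 'n" where b: "b \<in> Basis" using nonempty_Basis by blast
  have "(\<integral>\<^sup>+x. ennreal (exp (- (norm (x :: real ^ 'n))\<^sup>2)) \<partial>lborel)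
      = ennreal (sqrt pi ^ (CARD('n) - 1)) * ennreal (sqrt pi)"
    using nn_integral_gaussian_inner[of b "\<lambda>_. 1"] b by (simp add: nn_integral_exp_neg_square)
  also have "\<dots> = ennreal (sqrt pi ^ CARD('n))"
    using power_minus_mult[of "CARD('n)" "sqrt pi"] by (simp add: ennreal_mult[symmetric])
  finally show ?thesis .
qed

lemma nn_integral_gaussian_abs_inner:
  fixes v :: "real ^ 'n"
  shows "(\<integral>\<^sup>+x. ennreal \<bar>x \<bullet> v\<bar> * ennreal (exp (- (norm x)\<^sup>2)) \<partial>lborel)
    = ennreal (norm v * sqrt pi ^ (CARD('n) - 1))"
proof (cases "v = 0")
  case False
  have "(\<integral>\<^sup>+x. ennreal \<bar>x \<bullet> v\<bar> * ennreal (exp (- (norm x)\<^sup>2)) \<partial>lborel)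
      = (\<integral>\<^sup>+x. ennreal (norm v * \<bar>x \<bullet> sgn v\<bar>) * ennreal (exp (- (norm x)\<^sup>2)) \<partial>lborel)"
    using False by (intro nn_integral_cong) (simp add: sgn_div_norm abs_mult field_simps)
  also have "\<dots> = ennreal (sqrt pi ^ (CARD('n) - 1)) * (\<integral>\<^sup>+t. ennreal (norm v * \<bar>t\<bar>) * ennreal (exp (- t\<^sup>2)) \<partial>lborel)"
    using False by (intro nn_integral_gaussian_inner) (auto simp: norm_sgn)
  also have "(\<integral>\<^sup>+t. ennreal (norm v * \<bar>t\<bar>) * ennreal (exp (- t\<^sup>2)) \<partial>lborel)
      = ennreal (norm v) * (\<integral>\<^sup>+t. ennreal (\<bar>t\<bar> * exp (- t\<^sup>2)) \<partial>lborel)"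
    by (subst nn_integral_cmult[symmetric]) (auto simp: ennreal_mult mult.assoc)
  finally show ?thesis
    unfolding nn_integral_abs_exp_neg_square by (simp add: ennreal_mult mult.commute)
qed simp

text \<open>
  Up to a constant factor, the exponent is a weighted average of the functions \<open>\<bar>x \<bullet> u\<bar>\<close> for unit
  vectors \<open>u\<close>, so convexity of the exponential function reduces the bound to a single \<open>u\<close>.
\<close>
lemma nn_integral_gaussian_exp_sum_abs_inner_le:
  fixes v :: "'i \<Rightarrow> real ^ 'n"
  assumes I: "finite I" and W: "W > 0" "W \<le> (\<Sum>i\<in>I. norm (v i))" and \<epsilon>: "\<epsilon> > 0"
  shows "(\<integral>\<^sup>+x. ennreal (exp (- (\<Sum>i\<in>I. \<bar>x \<bullet> v i\<bar>) / \<epsilon>)) * ennreal (exp (- (norm x)\<^sup>2)) \<partial>lborel)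
    \<le> ennreal (sqrt pi ^ (CARD('n) - 1) * (2 * \<epsilon> / W))"
proof -
  \<comment> \<open>The estimate is carried out with the exact total length \<open>V\<close>, so
    that the weights \<open>w\<close> sum to \<open>1\<close>; only the last step passes to
    \<open>W \<le> V\<close>.\<close>
  define V where "V = (\<Sum>i\<in>I. norm (v i))"
  define w where "w = (\<lambda>i. norm (v i) / V)"
  let ?p = "sqrt pi ^ (CARD('n) - 1)"
  let ?e = "\<lambda>x::real^'n. ennreal (exp (- (norm x)\<^sup>2))"
  have V: "V > 0" using W by (simp add: V_def)
  have w0: "w i \<ge> 0" for i using V by (simp add: w_def)
  have w1: "(\<Sum>i\<in>I. w i) = 1" using V by (simp add: w_def V_def sum_divide_distrib[symmetric])
  have "I \<noteq> {}" using w1 by auto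
  have conv: "exp (- (\<Sum>i\<in>I. \<bar>x \<bullet> v i\<bar>) / \<epsilon>) \<le> (\<Sum>i\<in>I. w i * exp (- (V / \<epsilon>) * \<bar>x \<bullet> sgn (v i)\<bar>))" for x
  proof -
    have "w i * (- (V / \<epsilon>) * \<bar>x \<bullet> sgn (v i)\<bar>) = - \<bar>x \<bullet> v i\<bar> / \<epsilon>" for i
      using V \<epsilon> by (cases "v i = 0") (auto simp: w_def sgn_div_norm abs_mult field_simps)
    then have "(\<Sum>i\<in>I. w i *\<^sub>R (- (V / \<epsilon>) * \<bar>x \<bullet> sgn (v i)\<bar>)) = (\<Sum>i\<in>I. - \<bar>x \<bullet> v i\<bar> / \<epsilon>)"
      by (simp only: real_scaleR_def)
    also have "\<dots> = - (\<Sum>i\<in>I. \<bar>x \<bullet> v i\<bar>) / \<epsilon>"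
      by (simp add: sum_negf sum_divide_distrib)
    finally have "- (\<Sum>i\<in>I. \<bar>x \<bullet> v i\<bar>) / \<epsilon> = (\<Sum>i\<in>I. w i *\<^sub>R (- (V / \<epsilon>) * \<bar>x \<bullet> sgn (v i)\<bar>))"
      by (rule sym)
    then show ?thesis
      using convex_on_sum[OF I \<open>I \<noteq> {}\<close> exp_convex w1, of "\<lambda>i. - (V / \<epsilon>) * \<bar>x \<bullet> sgn (v i)\<bar>"] w0 by simp
  qed
  have single: "(\<integral>\<^sup>+x. ennreal (w i) * (ennreal (exp (- (V / \<epsilon>) * \<bar>x \<bullet> sgn (v i)\<bar>)) * ?e x) \<partial>lborel)
      \<le> ennreal (w i * (?p * (2 * \<epsilon> / V)))" for i
  \<comment> \<open>A zero vector has no direction, but its weight \<open>w i\<close> is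
    \<open>0\<close> as well.\<close>
  proof (cases "v i = 0")
    case False
    have "(\<integral>\<^sup>+x. ennreal (exp (- (V / \<epsilon>) * \<bar>x \<bullet> sgn (v i)\<bar>)) * ?e x \<partial>lborel)
        = ennreal ?p * (\<integral>\<^sup>+t. ennreal (exp (- (V / \<epsilon>) * \<bar>t\<bar>)) * ennreal (exp (- t\<^sup>2)) \<partial>lborel)"
      using False by (intro nn_integral_gaussian_inner) (auto simp: norm_sgn)
    also have "\<dots> \<le> ennreal ?p * ennreal (2 / (V / \<epsilon>))"
      using nn_integral_exp_neg_abs_gaussian_le[of "V / \<epsilon>"] V \<epsilon>
      by (intro mult_left_mono) (simp_all add: ennreal_mult)
    also have "\<dots> = ennreal (?p * (2 * \<epsilon> / V))"
      using V \<epsilon> by (simp add: ennreal_mult[symmetric])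
    finally have "ennreal (w i) * (\<integral>\<^sup>+x. ennreal (exp (- (V / \<epsilon>) * \<bar>x \<bullet> sgn (v i)\<bar>)) * ?e x \<partial>lborel)
        \<le> ennreal (w i) * ennreal (?p * (2 * \<epsilon> / V))"
      by (intro mult_left_mono) simp_all
    also have "\<dots> = ennreal (w i * (?p * (2 * \<epsilon> / V)))"
      using V \<epsilon> w0 by (intro ennreal_mult[symmetric]) auto
    finally show ?thesis by (subst nn_integral_cmult) simp_all
  qed (simp add: w_def)
  have "(\<integral>\<^sup>+x. ennreal (exp (- (\<Sum>i\<in>I. \<bar>x \<bullet> v i\<bar>) / \<epsilon>)) * ?e x \<partial>lborel)
      \<le> (\<integral>\<^sup>+x. (\<Sum>i\<in>I. ennreal (w i) * (ennreal (exp (- (V / \<epsilon>) * \<bar>x \<bullet> sgn (v i)\<bar>)) * ?e x)) \<partial>lborel)"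
  proof (intro nn_integral_mono)
    fix x
    have "ennreal (exp (- (\<Sum>i\<in>I. \<bar>x \<bullet> v i\<bar>) / \<epsilon>)) * ?e x
        \<le> ennreal (\<Sum>i\<in>I. w i * exp (- (V / \<epsilon>) * \<bar>x \<bullet> sgn (v i)\<bar>)) * ?e x"
      by (intro mult_right_mono ennreal_leI conv) simp
    also have "\<dots> = (\<Sum>i\<in>I. ennreal (w i) * (ennreal (exp (- (V / \<epsilon>) * \<bar>x \<bullet> sgn (v i)\<bar>)) * ?e x))"
      using w0 by (subst sum_ennreal[symmetric]) (auto simp: ennreal_mult sum_distrib_right mult.assoc)
    finally show "ennreal (exp (- (\<Sum>i\<in>I. \<bar>x \<bullet> v i\<bar>) / \<epsilon>)) * ?e x
        \<le> (\<Sum>i\<in>I. ennreal (w i) * (ennreal (exp (- (V / \<epsilon>) * \<bar>x \<bullet> sgn (v i)\<bar>)) * ?e x))" .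
  qed
  also have "\<dots> = (\<Sum>i\<in>I. \<integral>\<^sup>+x. ennreal (w i) * (ennreal (exp (- (V / \<epsilon>) * \<bar>x \<bullet> sgn (v i)\<bar>)) * ?e x) \<partial>lborel)"
    by (rule nn_integral_sum) simp
  also have "\<dots> \<le> (\<Sum>i\<in>I. ennreal (w i * (?p * (2 * \<epsilon> / V))))"
    by (intro sum_mono single)
  also have "\<dots> = ennreal (?p * (2 * \<epsilon> / V))"
    using w0 V \<epsilon> by (subst sum_ennreal) (auto simp only: sum_distrib_right[symmetric] w1, simp_all)
  also have "\<dots> \<le> ennreal (?p * (2 * \<epsilon> / W))"
    using W V \<epsilon> by (intro ennreal_leI mult_left_mono divide_left_mono) (auto simp: V_def)
  finally show ?thesis .
qed

section \<open>Lower bound for a minimum over finitely many matchings\<close>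

lemma nn_integral_gaussian_Min_sum_abs_inner_ge:
  fixes v :: "'p \<Rightarrow> 'i \<Rightarrow> real ^ 'n"
  assumes P: "finite P" "P \<noteq> {}" and I: "finite I" and W0: "W \<ge> 0"
    and W: "\<And>p. p \<in> P \<Longrightarrow> W \<le> (\<Sum>i\<in>I. norm (v p i))"
  shows "ennreal (W * pi / (8 * card P) * sqrt pi ^ (CARD('n) - 1))
    \<le> (\<integral>\<^sup>+x. ennreal (Min ((\<lambda>p. \<Sum>i\<in>I. \<bar>x \<bullet> v p i\<bar>) ` P)) * ennreal (exp (- (norm x)\<^sup>2)) \<partial>lborel)"
proof (cases "W = 0")
  case False
  define f where "f = (\<lambda>p x. \<Sum>i\<in>I. \<bar>x \<bullet> v p i\<bar>)"
  define H where "H = (\<lambda>x. Min ((\<lambda>p. f p x) ` P))"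
  \<comment> \<open>Chosen so that \<open>card P * (2 * \<epsilon> / W) = sqrt pi / 2\<close>, which
    makes the integrated error term exactly half of the left-hand side.\<close>
  define \<epsilon> where "\<epsilon> = W * sqrt pi / (4 * card P)"
  let ?p = "sqrt pi ^ (CARD('n) - 1)"
  let ?e = "\<lambda>x::real^'n. ennreal (exp (- (norm x)\<^sup>2))"
  have card: "card P > 0" using P by (simp add: card_gt_0_iff)
  have Wp: "W > 0" using False W0 by simp
  then have \<epsilon>: "\<epsilon> > 0" using card by (simp add: \<epsilon>_def)
  have fm [measurable]: "f p \<in> borel_measurable borel" for p unfolding f_def by measurable
  have Hm [measurable]: "H \<in> borel_measurable borel"
    unfolding H_def by (rule borel_measurable_Min[OF P(1)]) simp
  have H_in: "H x \<in> (\<lambda>p. f p x) ` P" for x unfolding H_def using P by (intro Min_in) auto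
  have H0: "H x \<ge> 0" for x using H_in[of x] by (auto simp: f_def intro!: sum_nonneg)
  \<comment> \<open>The minimum is attained at some \<open>q\<close>. The inequality
    \<open>1 - t \<le> exp (- t)\<close> with \<open>t = H x / \<epsilon>\<close> handles that term,
    and the other summands are nonnegative. Summing over all of \<open>P\<close> removes the
    dependence of \<open>q\<close> on \<open>x\<close>.\<close>
  have key: "\<epsilon> \<le> H x + (\<Sum>p\<in>P. \<epsilon> * exp (- f p x / \<epsilon>))" for x
  proof -
    obtain q where q: "q \<in> P" "H x = f q x" using H_in[of x] by auto
    have "\<epsilon> * (1 + - H x / \<epsilon>) \<le> \<epsilon> * exp (- H x / \<epsilon>)"
      using \<epsilon> by (intro mult_left_mono exp_ge_add_one_self) auto
    also have "\<dots> \<le> (\<Sum>p\<in>P. \<epsilon> * exp (- f p x / \<epsilon>))"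
      unfolding q(2) using q(1) P \<epsilon> by (intro member_le_sum) auto
    finally have "\<epsilon> * (1 + - H x / \<epsilon>) \<le> (\<Sum>p\<in>P. \<epsilon> * exp (- f p x / \<epsilon>))" .
    moreover have "\<epsilon> * (1 + - H x / \<epsilon>) = \<epsilon> - H x" using \<epsilon> by (simp add: field_simps)
    ultimately show ?thesis by linarith
  qed
  have pn: "sqrt pi ^ CARD('n) = sqrt pi * ?p"
    using power_minus_mult[of "CARD('n)" "sqrt pi"] by (simp add: mult.commute)
  have "ennreal (\<epsilon> * (sqrt pi * ?p)) = (\<integral>\<^sup>+x. ennreal \<epsilon> * ?e x \<partial>lborel)"
    using \<epsilon> by (simp add: nn_integral_cmult nn_integral_gaussian_vec pn ennreal_mult)
  also have "\<dots> \<le> (\<integral>\<^sup>+x. ennreal (H x) * ?e x + (\<Sum>p\<in>P. ennreal \<epsilon> * (ennreal (exp (- f p x / \<epsilon>)) * ?e x)) \<partial>lborel)"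
  proof (intro nn_integral_mono)
    fix x
    have "ennreal \<epsilon> * ?e x \<le> ennreal (H x + (\<Sum>p\<in>P. \<epsilon> * exp (- f p x / \<epsilon>))) * ?e x"
      by (intro mult_right_mono ennreal_leI key) simp
    also have "\<dots> = ennreal (H x) * ?e x + (\<Sum>p\<in>P. ennreal \<epsilon> * (ennreal (exp (- f p x / \<epsilon>)) * ?e x))"
    proof -
      have "ennreal (\<Sum>p\<in>P. \<epsilon> * exp (- f p x / \<epsilon>)) = (\<Sum>p\<in>P. ennreal \<epsilon> * ennreal (exp (- f p x / \<epsilon>)))"
        using \<epsilon> by (subst sum_ennreal[symmetric]) (auto simp: ennreal_mult)
      then show ?thesis
        using \<epsilon> H0 by (subst ennreal_plus) (auto simp: sum_nonneg distrib_right sum_distrib_right mult.assoc)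
    qed
    finally show "ennreal \<epsilon> * ?e x
        \<le> ennreal (H x) * ?e x + (\<Sum>p\<in>P. ennreal \<epsilon> * (ennreal (exp (- f p x / \<epsilon>)) * ?e x))" .
  qed
  also have "\<dots> = (\<integral>\<^sup>+x. ennreal (H x) * ?e x \<partial>lborel)
      + (\<Sum>p\<in>P. ennreal \<epsilon> * (\<integral>\<^sup>+x. ennreal (exp (- f p x / \<epsilon>)) * ?e x \<partial>lborel))"
    by (subst nn_integral_add) (auto simp: nn_integral_sum nn_integral_cmult)
  also have "\<dots> \<le> (\<integral>\<^sup>+x. ennreal (H x) * ?e x \<partial>lborel) + (\<Sum>p\<in>P. ennreal \<epsilon> * ennreal (?p * (2 * \<epsilon> / W)))"
    unfolding f_def
    by (intro add_left_mono sum_mono mult_left_mono nn_integral_gaussian_exp_sum_abs_inner_le I Wp W \<epsilon>) auto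
  also have "(\<Sum>p\<in>P. ennreal \<epsilon> * ennreal (?p * (2 * \<epsilon> / W))) = ennreal (card P * (\<epsilon> * (?p * (2 * \<epsilon> / W))))"
    using \<epsilon> Wp by (simp add: ennreal_mult[symmetric] ennreal_of_nat_eq_real_of_nat)
  also have "card P * (\<epsilon> * (?p * (2 * \<epsilon> / W))) = \<epsilon> * (sqrt pi * ?p) / 2"
    using card Wp by (simp add: \<epsilon>_def field_simps)
  finally have le: "ennreal (\<epsilon> * (sqrt pi * ?p))
      \<le> (\<integral>\<^sup>+x. ennreal (H x) * ?e x \<partial>lborel) + ennreal (\<epsilon> * (sqrt pi * ?p) / 2)" .
  have "ennreal (\<epsilon> * (sqrt pi * ?p) / 2) \<le> (\<integral>\<^sup>+x. ennreal (H x) * ?e x \<partial>lborel)"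
  \<comment> \<open>Half of the left-hand side is subtracted in the reals; an infinite integral
    makes the claim trivial.\<close>
  proof (cases "\<integral>\<^sup>+x. ennreal (H x) * ?e x \<partial>lborel")
    case (real r)
    have "\<epsilon> * (sqrt pi * ?p) \<le> r + \<epsilon> * (sqrt pi * ?p) / 2"
      using le real \<epsilon> by (simp add: ennreal_plus[symmetric] ennreal_le_iff del: ennreal_plus)
    then show ?thesis using real by (simp add: ennreal_leI)
  qed simp
  also have "\<epsilon> * (sqrt pi * ?p) / 2 = W * pi / (8 * card P) * ?p"
    by (simp add: \<epsilon>_def)
  finally show ?thesis unfolding H_def f_def .
qed simp

section \<open>Comparison of the sliced and the full distance of empirical measures\<close>

theorem theorem3:
  fixes k :: nat and x y :: "nat \<Rightarrow> real ^ 'n" and \<alpha> \<beta> :: "(real ^ 'n) measure"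
  assumes "CARD('n) \<ge> 3" and "k \<ge> 1"
    and "\<alpha> = empirical k x" and "\<beta> = empirical k y"
  shows "1 / (16 * exp 1 * fact k) * kappa TYPE(real ^ 'n) * W1 k \<alpha> \<beta> \<le> sliced_W1 k \<alpha> \<beta>
    \<and> sliced_W1 k \<alpha> \<beta> \<le> kappa TYPE(real ^ 'n) * W1 k \<alpha> \<beta>"
proof -
  define P where "P = {\<pi>. \<pi> permutes {1..k}}"
  define v where "v = (\<lambda>\<pi> i. x i - y (\<pi> i))"
  define f where "f = (\<lambda>\<pi> \<theta>. \<Sum>i=1..k. \<bar>\<theta> \<bullet> v \<pi> i\<bar>)"
  \<comment> \<open>\<open>H\<close> and \<open>W\<close> are the sliced and the full optimal cost
    without the factor \<open>1 / k\<close>, which is restored only at the end.\<close>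
  define H where "H = (\<lambda>\<theta>. Min ((\<lambda>\<pi>. f \<pi> \<theta>) ` P))"
  define W where "W = Min ((\<lambda>\<pi>. \<Sum>i=1..k. norm (v \<pi> i)) ` P)"
  define c where "c = 2 / Gamma ((real CARD('n) + 1) / 2)"
  define E where "E = (\<integral>\<^sup>+\<theta>. ennreal (H \<theta>) * ennreal (exp (- (norm \<theta>)\<^sup>2)) \<partial>lborel)"
  define J where "J = (\<integral>\<^sup>+\<theta>. ennreal (H \<theta>) \<partial>sphere_measure)"
  let ?p = "sqrt pi ^ (CARD('n) - 1)"
  have P: "finite P" "P \<noteq> {}" "card P = fact k"
    unfolding P_def using permutes_id[of "{1..k}"]
    by (auto simp: finite_permutations card_permutations simp del: permutes_id)
  have W1: "W1 k \<alpha> \<beta> = W / k"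
    unfolding assms(3,4) W1_empirical[OF assms(2)]
    by (simp add: matching_cost_def W_def P_def v_def dist_norm)
  have "matching_cost k (\<lambda>i. x i \<bullet> \<theta>) (\<lambda>i. y i \<bullet> \<theta>) = H \<theta> / k" for \<theta>
    by (simp add: matching_cost_def H_def P_def f_def v_def dist_real_def inner_diff_right inner_commute)
  then have sliced: "sliced_W1 k \<alpha> \<beta> = (\<integral>\<theta>. H \<theta> / k \<partial>sphere_measure)"
    unfolding assms(3,4) sliced_W1_def proj_pushforward_empirical W1_empirical[OF assms(2)] by simp
  have fm [measurable]: "f \<pi> \<in> borel_measurable borel" for \<pi> unfolding f_def by measurable
  have Hm [measurable]: "H \<in> borel_measurable borel"
    unfolding H_def by (rule borel_measurable_Min[OF P(1)]) simp
  have sets: "sets (sphere_measure :: (real ^ 'n) measure) = sets (restrict_space borel (sphere 0 1))"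
    by (simp add: sphere_measure_def)
  have Hs: "H \<in> borel_measurable sphere_measure"
    unfolding measurable_cong_sets[OF sets refl] by (rule measurable_restrict_space1) simp
  have H_in: "H \<theta> \<in> (\<lambda>\<pi>. f \<pi> \<theta>) ` P" for \<theta> unfolding H_def using P by (intro Min_in) auto
  have H0: "H \<theta> \<ge> 0" for \<theta> using H_in[of \<theta>] by (auto simp: f_def intro!: sum_nonneg)
  have H_le: "H \<theta> \<le> f \<pi> \<theta>" if "\<pi> \<in> P" for \<pi> \<theta> unfolding H_def using P that by (intro Min_le) auto
  \<comment> \<open>Homogeneity is what permits replacing the sphere integral \<open>J\<close> by
    the Gaussian integral \<open>E\<close>.\<close>
  have hom: "H (r *\<^sub>R \<theta>) = r * H \<theta>" if "r > 0" for r \<theta>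
  proof -
    have "r * H \<theta> = Min ((*) r ` (\<lambda>\<pi>. f \<pi> \<theta>) ` P)"
      unfolding H_def using that P by (intro mono_Min_commute) (auto intro!: monoI mult_left_mono)
    also have "(*) r ` (\<lambda>\<pi>. f \<pi> \<theta>) ` P = (\<lambda>\<pi>. f \<pi> (r *\<^sub>R \<theta>)) ` P"
      using that by (simp add: image_image f_def abs_mult sum_distrib_left)
    finally show ?thesis by (simp add: H_def)
  qed
  have "W \<in> (\<lambda>\<pi>. \<Sum>i=1..k. norm (v \<pi> i)) ` P" unfolding W_def using P by (intro Min_in) auto
  then obtain \<pi> where \<pi>: "\<pi> \<in> P" "W = (\<Sum>i=1..k. norm (v \<pi> i))" by blast
  have W0: "W \<ge> 0" unfolding \<pi>(2) by (intro sum_nonneg) auto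
  have W_le: "W \<le> (\<Sum>i=1..k. norm (v \<sigma> i))" if "\<sigma> \<in> P" for \<sigma>
    unfolding W_def using P that by (intro Min_le) auto
  have E_ge: "ennreal (W * pi / (8 * fact k) * ?p) \<le> E"
    unfolding E_def H_def f_def
    using nn_integral_gaussian_Min_sum_abs_inner_ge[OF P(1,2) _ W0 W_le] P(3) by simp
  \<comment> \<open>A matching optimal for the full cost is admissible in every direction, and its
    sliced cost has an explicit Gaussian integral.\<close>
  have "E \<le> (\<integral>\<^sup>+\<theta>. (\<Sum>i=1..k. ennreal \<bar>\<theta> \<bullet> v \<pi> i\<bar> * ennreal (exp (- (norm \<theta>)\<^sup>2))) \<partial>lborel)"
    unfolding E_def
  proof (intro nn_integral_mono)
    fix \<theta>
    have "ennreal (H \<theta>) \<le> ennreal (f \<pi> \<theta>)"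
      by (rule ennreal_leI) (rule H_le[OF \<pi>(1)])
    also have "\<dots> = (\<Sum>i=1..k. ennreal \<bar>\<theta> \<bullet> v \<pi> i\<bar>)"
      unfolding f_def by (rule sum_ennreal[symmetric]) simp
    finally show "ennreal (H \<theta>) * ennreal (exp (- (norm \<theta>)\<^sup>2))
        \<le> (\<Sum>i=1..k. ennreal \<bar>\<theta> \<bullet> v \<pi> i\<bar> * ennreal (exp (- (norm \<theta>)\<^sup>2)))"
      unfolding sum_distrib_right[symmetric] by (rule mult_right_mono) simp
  qed
  also have "\<dots> = ennreal (W * ?p)"
    by (simp add: nn_integral_sum nn_integral_gaussian_abs_inner \<pi>(2) sum_distrib_right)
  finally have E_le: "E \<le> ennreal (W * ?p)" .
  \<comment> \<open>This crude Cauchy-Schwarz bound serves only to show that \<open>J\<close> is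
    finite, as the conversion to \<open>E\<close> requires.\<close>
  have "J \<le> (\<integral>\<^sup>+\<theta>. ennreal W \<partial>(sphere_measure :: (real ^ 'n) measure))"
    unfolding J_def
  proof (intro nn_integral_mono ennreal_leI)
    fix \<theta> :: "real ^ 'n" assume "\<theta> \<in> space sphere_measure"
    then have "norm \<theta> = 1" by (simp add: sphere_measure_def space_scale_measure space_restrict_space)
    then have "f \<pi> \<theta> \<le> W"
      unfolding f_def \<pi>(2) by (intro sum_mono) (metis Cauchy_Schwarz_ineq2 mult_1)
    then show "H \<theta> \<le> W" using H_le[OF \<pi>(1), of \<theta>] by linarith
  qed
  also have "\<dots> = ennreal W * emeasure (sphere_measure :: (real ^ 'n) measure) (sphere 0 1)"
    by (simp add: sphere_measure_def space_scale_measure space_restrict_space)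
  also have "\<dots> < \<infinity>"
    by (simp add: emeasure_sphere_measure_sphere ennreal_mult_less_top)
  finally have "J < \<infinity>" .
  then have J: "J = ennreal c * E"
    unfolding J_def E_def c_def
    by (subst nn_integral_sphere_measure_eq_gaussian) (auto simp: hom H0 ennreal_mult)
  obtain e where e: "E = ennreal e" "e \<ge> 0" using E_le by (cases E) (auto simp: top_unique)
  have e_le: "e \<le> W * ?p" using E_le W0 e by (simp add: ennreal_le_iff)
  have e_ge: "W * pi / (8 * fact k) * ?p \<le> e" using E_ge W0 e by (simp add: ennreal_le_iff)
  have c0: "c > 0" by (simp add: c_def Gamma_real_pos)
  have kappa: "kappa TYPE(real ^ 'n) = c * ?p"
    using assms(1) by (subst kappa_eq) (simp_all add: c_def)
  have "(\<integral>\<theta>. H \<theta> \<partial>sphere_measure) = enn2real J"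
    unfolding J_def using Hs H0 by (intro integral_eq_nn_integral) auto
  then have sl: "sliced_W1 k \<alpha> \<beta> = c * e / k"
    unfolding sliced J using e c0 by (simp add: ennreal_mult[symmetric])
  \<comment> \<open>The argument yields the factor \<open>pi / (8 * fact k)\<close>, which dominates
    the claimed \<open>1 / (16 * exp 1 * fact k)\<close>.\<close>
  have "1 \<le> exp (1::real) * pi" using mult_mono[of 1 "exp (1::real)" 1 pi] pi_ge_two by simp
  then have "8 \<le> 16 * exp (1::real) * pi" by linarith
  then have "1 / (16 * exp 1 * fact k) \<le> pi / (8 * fact k :: real)"
    by (simp add: field_simps)
  then have "1 / (16 * exp 1 * fact k) * (W * ?p) \<le> pi / (8 * fact k) * (W * ?p)"
    using W0 by (intro mult_right_mono) auto
  also have "\<dots> \<le> e" using e_ge by (simp add: field_simps)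
  finally have "c * (1 / (16 * exp 1 * fact k) * (W * ?p)) / k \<le> c * e / k"
    using c0 by (intro divide_right_mono mult_left_mono) auto
  moreover have "c * e / k \<le> c * (W * ?p) / k"
    using c0 e_le by (intro divide_right_mono mult_left_mono) auto
  ultimately show ?thesis
    unfolding sl kappa W1 by (simp add: mult_ac)
qed

end
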